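(* Let $X$ be a separable Banach space. Then $X$ fails the Infinite Sprawling Tree Property if and only if $ST(X)<\omega_1$.
   Context: All Banach spaces are real; $B_X$ is the closed unit ball. $\omega=\{0,1,2,\dots\}$, $\omega_1$ is the first uncountable ordinal. For every limit ordinal $\alpha<\omega_1$ fix once and for all an enumeration $(\beta_n)_{n\in\omega}$ of all ordinals less than $\alpha$. For finite sequences $s,t$, $s\cdot t$ denotes their concatenation ($s$ followed by $t$); a single element $a$ (such as a pair $(0,n)$ or $(1,n)$) is identified with the one-term sequence consisting of $a$, and $a\cdot S=\{a\cdot t:t\in S\}$ for a set $S$ of finite sequences. Sets $S_\alpha$ ($\alpha<\omega_1$) of finite sequences in $\{0,1\}\times\omega$ are defined by: $S_0=\{\varnothing\}$; $S_{\alpha+1}=\{\varnothing\}\cup\bigcup_{n\in\omega}\big((0,n)\cdot S_\alpha\cup(1,n)\cdot S_\alpha\big)$; for $\alpha$ limit, $S_\alpha=\{\varnothing\}\cup\bigcup_{n\in\omega}(0,n)\cdot S_{\beta_n}$. Every $s\in S_\alpha$ is of one of three types: (A) $s$ has no successor in $S_\alpha$; (B) its successors are all $s\cdot(0,n)$ and all $s\cdot(1,n)$, $n\in\omega$; (C) its successors are exactly all $s\cdot(0,n)$, $n\in\omega$. For $\delta>0$, a $\delta$-$\alpha$-sprawling tree in $X$ is a family $(x_s)_{s\in S_\alpha}\subset X$ such that: if $s$ is of type (B), then $x_s=\frac12(x_{s\cdot(0,n)}+x_{s\cdot(1,n)})$ for all $n\in\omega$ and $\|x_{s\cdot(0,n)}-x_{s\cdot(0,m)}\|\ge\delta$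 for all $n\ne m$; if $s$ is of type (C), then $x_s=x_{s\cdot(0,n)}$ for all $n\in\omega$. For $\delta>0$, $ST(X,\delta)=\inf\{\alpha<\omega_1: B_X\text{ does not contain a }\delta\text{-}\alpha\text{-sprawling tree}\}$ if this set is nonempty, and $ST(X,\delta)=\infty$ otherwise (with $\alpha<\infty$ for all ordinals $\alpha$); $ST(X)=\sup_{\delta>0}ST(X,\delta)$. $X$ has the Infinite Sprawling Tree Property if there exist $\delta>0$ and $f:(\{0,1\}\times\omega)^{<\omega}\to B_X$ (defined on all finite sequences in $\{0,1\}\times\omega$) such that for all $s$: $f(s)=\frac12(f(s\cdot(0,n))+f(s\cdot(1,n)))$ for all $n\in\omega$, and $\|f(s\cdot(0,n))-f(s\cdot(0,m))\|\ge\delta$ for all $n\neq m$. *)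

theory Defs
  imports "HOL-Analysis.Analysis"
begin

section \<open>The countable ordinals\<close>

text \<open>
  HOL has no type of ordinals.  The cardinal successor of \<open>\<omega>\<close> is a well-order of order type
  \<open>\<omega>\<^sub>1\<close>, so its field, with the order it carries, represents the set of countable ordinals.
\<close>

typedef omega1 = "Field (cardSuc natLeq)"
proof -
  have "infinite (Field (cardSuc natLeq))"
    using cardSuc_finite[OF natLeq_Card_order] by (simp add: Field_natLeq)
  then show ?thesis by (metis ex_in_conv finite.emptyI)
qed

lemma Well_order_cardSuc_natLeq: "Well_order (cardSuc natLeq)"
  using cardSuc_Card_order[OF natLeq_Card_order] by (simp add: card_order_on_well_order_on)

instantiation omega1 :: linorder
begin

definition less_eq_omega1 :: "omega1 \<Rightarrow> omega1 \<Rightarrow> bool" where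
  "x \<le> y \<longleftrightarrow> (Rep_omega1 x, Rep_omega1 y) \<in> cardSuc natLeq"

definition less_omega1 :: "omega1 \<Rightarrow> omega1 \<Rightarrow> bool" where
  "x < y \<longleftrightarrow> x \<le> y \<and> x \<noteq> y" for x y :: omega1

instance
proof
  have W: "refl_on (Field (cardSuc natLeq)) (cardSuc natLeq)" "trans (cardSuc natLeq)"
    "antisym (cardSuc natLeq)" "total_on (Field (cardSuc natLeq)) (cardSuc natLeq)"
    using Well_order_cardSuc_natLeq by (auto simp: order_on_defs)
  fix x y z :: omega1
  show refl: "x \<le> x"
    using W(1) Rep_omega1[of x] by (auto simp: less_eq_omega1_def refl_on_def)
  show "x \<le> z" if "x \<le> y" "y \<le> z"
    using that W(2) by (auto simp: less_eq_omega1_def dest: transD)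
  show antisym: "x = y" if "x \<le> y" "y \<le> x"
    using that W(3) by (auto simp: less_eq_omega1_def Rep_omega1_inject dest: antisymD)
  show "x < y \<longleftrightarrow> x \<le> y \<and> \<not> y \<le> x"
    using antisym refl by (auto simp: less_omega1_def)
  show "x \<le> y \<or> y \<le> x"
    using W(4) refl Rep_omega1[of x] Rep_omega1[of y]
    by (metis Rep_omega1_inject less_eq_omega1_def total_on_def)
qed

end

instance omega1 :: wellorder
proof
  fix P :: "omega1 \<Rightarrow> bool" and a
  assume step: "\<And>x. (\<And>y. y < x \<Longrightarrow> P y) \<Longrightarrow> P x"
  have "wf (cardSuc natLeq - Id)"
    using Well_order_cardSuc_natLeq by (simp add: well_order_on_def)
  then have "wf (inv_image (cardSuc natLeq - Id) Rep_omega1)"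
    by (rule wf_inv_image)
  moreover have "inv_image (cardSuc natLeq - Id) Rep_omega1 = {(x, y). x < y}"
    by (auto simp: inv_image_def less_omega1_def less_eq_omega1_def Rep_omega1_inject)
  ultimately have "wf {(x :: omega1, y). x < y}" by simp
  then show "P a" by (rule wf_induct_rule) (use step in auto)
qed

lemma uncountable_omega1:
  includes cardinal_syntax
  shows "uncountable (UNIV :: omega1 set)"
proof
  assume "countable (UNIV :: omega1 set)"
  then have "countable (range Rep_omega1)" by (rule countable_image)
  then have "countable (Field (cardSuc natLeq))"
    by (simp add: type_definition.Rep_range[OF type_definition_omega1])
  then have "|Field (cardSuc natLeq)| \<le>o |UNIV :: nat set|"
    unfolding countable_def card_of_ordLeq[symmetric] by auto
  then have "|Field (cardSuc natLeq)| \<le>o natLeq"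
    using card_of_nat ordLeq_ordIso_trans by blast
  then have "cardSuc natLeq \<le>o natLeq"
    using card_of_Field_ordIso[OF cardSuc_Card_order[OF natLeq_Card_order]]
      ordIso_ordLeq_trans ordIso_symmetric by blast
  then show False
    using cardSuc_greater[OF natLeq_Card_order] not_ordLess_ordLeq by blast
qed

lemma countable_lessThan_omega1:
  includes cardinal_syntax
  shows "countable {..<a :: omega1}"
proof -
  have "|underS (cardSuc natLeq) (Rep_omega1 a)| <o cardSuc natLeq"
    using card_of_underS[OF cardSuc_Card_order[OF natLeq_Card_order] Rep_omega1] .
  then have "|underS (cardSuc natLeq) (Rep_omega1 a)| \<le>o natLeq"
    using cardSuc_ordLeq_ordLess[OF natLeq_Card_order card_of_Card_order] by blast
  then have "|underS (cardSuc natLeq) (Rep_omega1 a)| \<le>o |UNIV :: nat set|"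
    using card_of_nat ordIso_symmetric ordLeq_ordIso_trans by blast
  then have "countable (underS (cardSuc natLeq) (Rep_omega1 a))"
    by (metis card_of_ordLeq countable_def inj_on_subset subset_UNIV)
  moreover have "Rep_omega1 ` {..<a} \<subseteq> underS (cardSuc natLeq) (Rep_omega1 a)"
    by (auto simp: underS_def less_omega1_def less_eq_omega1_def Rep_omega1_inject)
  ultimately have "countable (Rep_omega1 ` {..<a})" by (rule countable_subset[rotated])
  then show ?thesis
    by (rule countable_image_inj_on) (auto simp: inj_on_def Rep_omega1_inject)
qed

lemma ex_greater_omega1: "\<exists>b :: omega1. a < b"
proof (rule ccontr)
  assume "\<not> ?thesis"
  then have "(UNIV :: omega1 set) = insert a {..<a}"
    using less_linear by auto
  then show False
    using uncountable_omega1 countable_lessThan_omega1 by (metis countable_insert)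
qed

definition ozero :: omega1 where
  "ozero = (LEAST a. True)"

definition osuc :: "omega1 \<Rightarrow> omega1" where
  "osuc a = (LEAST b. a < b)"

definition olimit :: "omega1 \<Rightarrow> bool" where
  "olimit a \<longleftrightarrow> a \<noteq> ozero \<and> (\<forall>b. a \<noteq> osuc b)"

lemma ozero_le: "ozero \<le> a"
  unfolding ozero_def by (simp add: Least_le)

lemma less_osuc: "a < osuc a"
  unfolding osuc_def using LeastI_ex[OF ex_greater_omega1] .

lemma osuc_le_iff: "osuc a \<le> b \<longleftrightarrow> a < b"
  using less_osuc[of a] by (metis Least_le less_le_trans osuc_def)

lemma less_osuc_iff: "b < osuc a \<longleftrightarrow> b \<le> a"
  by (meson linorder_not_le osuc_le_iff)

lemma osuc_inject: "osuc a = osuc b \<longleftrightarrow> a = b"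
  by (metis less_osuc less_osuc_iff antisym)

lemma osuc_neq_ozero: "osuc a \<noteq> ozero"
  using less_osuc[of a] ozero_le[of a] by auto


section \<open>Countable ordinals together with \<open>\<omega>\<^sub>1\<close> and \<open>\<infinity>\<close>\<close>

text \<open>
  A supremum of countable ordinals is a countable ordinal or \<open>\<omega>\<^sub>1\<close>; together with \<open>\<infinity>\<close>, which
  lies above all ordinals, these are all values that an index can take.
\<close>

datatype ord_inf = Ctbl omega1 | Omega1 | Infty

instantiation ord_inf :: linorder
begin

fun less_eq_ord_inf :: "ord_inf \<Rightarrow> ord_inf \<Rightarrow> bool" where
  "Ctbl a \<le> Ctbl b \<longleftrightarrow> a \<le> b"
| "Ctbl a \<le> Omega1 \<longleftrightarrow> True"
| "Omega1 \<le> Ctbl b \<longleftrightarrow> False"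
| "Omega1 \<le> Omega1 \<longleftrightarrow> True"
| "Infty \<le> Ctbl b \<longleftrightarrow> False"
| "Infty \<le> Omega1 \<longleftrightarrow> False"
| "x \<le> Infty \<longleftrightarrow> True"

definition less_ord_inf :: "ord_inf \<Rightarrow> ord_inf \<Rightarrow> bool" where
  "x < y \<longleftrightarrow> x \<le> y \<and> \<not> y \<le> x" for x y :: ord_inf

instance
proof
  fix x y z :: ord_inf
  show "x < y \<longleftrightarrow> x \<le> y \<and> \<not> y \<le> x" by (rule less_ord_inf_def)
  show "x \<le> x" by (cases x) auto
  show "x \<le> z" if "x \<le> y" "y \<le> z" using that by (cases x; cases y; cases z) auto
  show "x = y" if "x \<le> y" "y \<le> x" using that by (cases x; cases y) auto
  show "x \<le> y \<or> y \<le> x" by (cases x; cases y) auto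
qed

end

instance ord_inf :: wellorder
proof
  fix P :: "ord_inf \<Rightarrow> bool" and x
  assume step: "\<And>x. (\<And>y. y < x \<Longrightarrow> P y) \<Longrightarrow> P x"
  have C: "P (Ctbl a)" for a
  proof (induction a rule: less_induct)
    case (less a)
    show ?case
    proof (rule step)
      fix y assume "y < Ctbl a"
      then show "P y" using less by (cases y) (auto simp: less_ord_inf_def not_le)
    qed
  qed
  have O: "P Omega1"
  proof (rule step)
    fix y assume "y < Omega1"
    then show "P y" using C by (cases y) (auto simp: less_ord_inf_def)
  qed
  have "P Infty"
  proof (rule step)
    fix y assume "y < Infty"
    then show "P y" using C O by (cases y) (auto simp: less_ord_inf_def)
  qed
  with C O show "P x" by (cases x) auto
qed

lemma le_Infty: "x \<le> Infty"
  by (cases x) auto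

instantiation ord_inf :: complete_linorder
begin

definition bot_ord_inf :: ord_inf where "bot = Ctbl ozero"
definition top_ord_inf :: ord_inf where "top = Infty"
definition inf_ord_inf :: "ord_inf \<Rightarrow> ord_inf \<Rightarrow> ord_inf" where "inf x y = min x y" for x y :: ord_inf
definition sup_ord_inf :: "ord_inf \<Rightarrow> ord_inf \<Rightarrow> ord_inf" where "sup x y = max x y" for x y :: ord_inf

definition Inf_ord_inf :: "ord_inf set \<Rightarrow> ord_inf" where
  "Inf A = (if A = {} then Infty else (LEAST x. x \<in> A))" for A :: "ord_inf set"

definition Sup_ord_inf :: "ord_inf set \<Rightarrow> ord_inf" where
  "Sup A = (LEAST x. \<forall>a\<in>A. a \<le> x)" for A :: "ord_inf set"

instance
proof
  fix x y z :: ord_inf and A :: "ord_inf set"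
  have S: "\<forall>a\<in>A. a \<le> Sup A"
    unfolding Sup_ord_inf_def by (rule LeastI[where k = Infty]) (simp add: le_Infty)
  show "Inf A \<le> x" if "x \<in> A"
    using that by (auto simp: Inf_ord_inf_def intro: Least_le)
  show "z \<le> Inf A" if "\<And>x. x \<in> A \<Longrightarrow> z \<le> x"
  proof (cases "A = {}")
    case False
    then have "(LEAST x. x \<in> A) \<in> A" by (metis LeastI ex_in_conv)
    with False that show ?thesis by (simp add: Inf_ord_inf_def)
  qed (simp add: Inf_ord_inf_def le_Infty)
  show "x \<le> Sup A" if "x \<in> A"
    using that S by blast
  show "Sup A \<le> z" if "\<And>x. x \<in> A \<Longrightarrow> x \<le> z"
    unfolding Sup_ord_inf_def using that by (auto intro: Least_le)
  have "Ctbl ozero \<le> z" for z by (cases z) (auto simp: ozero_le)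
  then show "Sup {} = (bot :: ord_inf)"
    by (simp add: Sup_ord_inf_def bot_ord_inf_def Least_equality)
  show "Inf {} = (top :: ord_inf)"
    by (simp add: Inf_ord_inf_def top_ord_inf_def)
qed (auto simp: inf_ord_inf_def sup_ord_inf_def)

end


section \<open>Sprawling trees\<close>

text \<open>
  Finite sequences in \<open>{0,1} \<times> \<omega>\<close> are lists over \<^typ>\<open>bool \<times> nat\<close>, with \<^const>\<open>False\<close> for \<open>0\<close> and
  \<^const>\<open>True\<close> for \<open>1\<close>.
\<close>

text \<open>
  \<open>\<beta> a\<close> is the enumeration chosen for the limit ordinal \<open>a\<close>; the values of \<open>\<beta>\<close> at other ordinals
  are irrelevant.
\<close>

definition limit_enumeration :: "(omega1 \<Rightarrow> nat \<Rightarrow> omega1) \<Rightarrow> bool" where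
  "limit_enumeration \<beta> \<longleftrightarrow> (\<forall>a. olimit a \<longrightarrow> range (\<beta> a) = {..<a})"

text \<open>
  The transfinite recursion defining the trees, as an inductive family of sets; the recursion
  equations are \<open>seq_tree_ozero\<close>, \<open>seq_tree_osuc\<close> and \<open>seq_tree_limit\<close> below.
\<close>

inductive seq_tree_mem :: "(omega1 \<Rightarrow> nat \<Rightarrow> omega1) \<Rightarrow> omega1 \<Rightarrow> (bool \<times> nat) list \<Rightarrow> bool"
  for \<beta> where
  empty: "seq_tree_mem \<beta> a []"
| osuc: "seq_tree_mem \<beta> a t \<Longrightarrow> seq_tree_mem \<beta> (osuc a) ((i, n) # t)"
| limit: "olimit a \<Longrightarrow> seq_tree_mem \<beta> (\<beta> a n) t \<Longrightarrow> seq_tree_mem \<beta> a ((False, n) # t)"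

definition seq_tree :: "(omega1 \<Rightarrow> nat \<Rightarrow> omega1) \<Rightarrow> omega1 \<Rightarrow> (bool \<times> nat) list set" where
  "seq_tree \<beta> a = {s. seq_tree_mem \<beta> a s}"

lemma seq_tree_ozero: "seq_tree \<beta> ozero = {[]}"
  by (auto simp: seq_tree_def olimit_def osuc_neq_ozero osuc_neq_ozero[symmetric]
      intro: seq_tree_mem.intros elim: seq_tree_mem.cases)

lemma seq_tree_osuc:
  "seq_tree \<beta> (osuc a) =
    {[]} \<union> (\<Union>n. (#) (False, n) ` seq_tree \<beta> a \<union> (#) (True, n) ` seq_tree \<beta> a)"
proof (intro equalityI subsetI)
  fix s assume "s \<in> seq_tree \<beta> (osuc a)"
  then have "seq_tree_mem \<beta> (osuc a) s" by (simp add: seq_tree_def)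
  then show "s \<in> {[]} \<union> (\<Union>n. (#) (False, n) ` seq_tree \<beta> a \<union> (#) (True, n) ` seq_tree \<beta> a)"
  proof cases
    case (osuc b t i n)
    then show ?thesis by (cases i) (auto simp: osuc_inject seq_tree_def)
  qed (auto simp: olimit_def)
qed (auto simp: seq_tree_def intro: seq_tree_mem.intros)

lemma seq_tree_limit:
  assumes "olimit a"
  shows "seq_tree \<beta> a = {[]} \<union> (\<Union>n. (#) (False, n) ` seq_tree \<beta> (\<beta> a n))"
proof (intro equalityI subsetI)
  fix s assume "s \<in> seq_tree \<beta> a"
  then have "seq_tree_mem \<beta> a s" by (simp add: seq_tree_def)
  then show "s \<in> {[]} \<union> (\<Union>n. (#) (False, n) ` seq_tree \<beta> (\<beta> a n))"
    using assms by cases (auto simp: olimit_def seq_tree_def)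
qed (use assms in \<open>auto simp: seq_tree_def intro: seq_tree_mem.intros\<close>)

definition successors :: "'b list set \<Rightarrow> 'b list \<Rightarrow> 'b list set" where
  "successors S s = {s @ [p] | p. s @ [p] \<in> S}"

definition type_B :: "(bool \<times> nat) list set \<Rightarrow> (bool \<times> nat) list \<Rightarrow> bool" where
  "type_B S s \<longleftrightarrow> successors S s = (\<Union>n. {s @ [(False, n)], s @ [(True, n)]})"

definition type_C :: "(bool \<times> nat) list set \<Rightarrow> (bool \<times> nat) list \<Rightarrow> bool" where
  "type_C S s \<longleftrightarrow> successors S s = (\<Union>n. {s @ [(False, n)]})"

text \<open>
  A family indexed by \<open>seq_tree \<beta> a\<close> is a function on all lists, of which only the values on
  \<open>seq_tree \<beta> a\<close> matter.
\<close>

definition sprawling_tree ::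
  "(omega1 \<Rightarrow> nat \<Rightarrow> omega1) \<Rightarrow> real \<Rightarrow> omega1 \<Rightarrow> ((bool \<times> nat) list \<Rightarrow> 'a::real_normed_vector) \<Rightarrow> bool"
  where
  "sprawling_tree \<beta> \<delta> a x \<longleftrightarrow>
    (\<forall>s \<in> seq_tree \<beta> a.
      (type_B (seq_tree \<beta> a) s \<longrightarrow>
        (\<forall>n. x s = (1/2) *\<^sub>R (x (s @ [(False, n)]) + x (s @ [(True, n)]))) \<and>
        (\<forall>n m. n \<noteq> m \<longrightarrow> norm (x (s @ [(False, n)]) - x (s @ [(False, m)])) \<ge> \<delta>)) \<and>
      (type_C (seq_tree \<beta> a) s \<longrightarrow> (\<forall>n. x s = x (s @ [(False, n)]))))"

definition ball_contains_sprawling_tree ::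
  "'a::real_normed_vector itself \<Rightarrow> (omega1 \<Rightarrow> nat \<Rightarrow> omega1) \<Rightarrow> real \<Rightarrow> omega1 \<Rightarrow> bool" where
  "ball_contains_sprawling_tree X \<beta> \<delta> a \<longleftrightarrow>
    (\<exists>x :: (bool \<times> nat) list \<Rightarrow> 'a.
      sprawling_tree \<beta> \<delta> a x \<and> x ` seq_tree \<beta> a \<subseteq> cball 0 1)"

text \<open>The infimum of the empty set in \<^typ>\<open>ord_inf\<close> is \<^const>\<open>Infty\<close>.\<close>

definition ST_delta ::
  "'a::real_normed_vector itself \<Rightarrow> (omega1 \<Rightarrow> nat \<Rightarrow> omega1) \<Rightarrow> real \<Rightarrow> ord_inf" where
  "ST_delta X \<beta> \<delta> = Inf {Ctbl a | a. \<not> ball_contains_sprawling_tree X \<beta> \<delta> a}"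

definition ST :: "'a::real_normed_vector itself \<Rightarrow> (omega1 \<Rightarrow> nat \<Rightarrow> omega1) \<Rightarrow> ord_inf" where
  "ST X \<beta> = (SUP \<delta>\<in>{0<..}. ST_delta X \<beta> \<delta>)"

definition infinite_sprawling_tree_property :: "'a::real_normed_vector itself \<Rightarrow> bool" where
  "infinite_sprawling_tree_property X \<longleftrightarrow>
    (\<exists>\<delta>>0. \<exists>f :: (bool \<times> nat) list \<Rightarrow> 'a. range f \<subseteq> cball 0 1 \<and>
      (\<forall>s. (\<forall>n. f s = (1/2) *\<^sub>R (f (s @ [(False, n)]) + f (s @ [(True, n)]))) \<and>
           (\<forall>n m. n \<noteq> m \<longrightarrow> norm (f (s @ [(False, n)]) - f (s @ [(False, m)])) \<ge> \<delta>)))"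

end

theory Submission
  imports Defs
begin

text \<open>
  For \<open>\<delta> > 0\<close> and a set \<open>K\<close>, let \<open>sprawl \<delta> K\<close> be the set of the points that are the common midpoint
  of infinitely many pairs of points of \<open>K\<close> whose first components are \<open>\<delta>\<close>-separated, and let
  \<open>roots \<beta> \<delta> a\<close> be the set of the roots of the \<open>\<delta>\<close>-\<open>a\<close>-sprawling trees in the unit ball.  The root
  sets are the transfinite iterates of the monotone operator \<open>sprawl \<delta>\<close>, starting from the ball
  (lemmas \<open>roots_ozero\<close>, \<open>roots_osuc\<close>, \<open>roots_limit\<close>), and the Infinite Sprawling Tree Property says
  that for some \<open>\<delta>\<close> the ball contains a nonempty set \<open>K \<subseteq> sprawl \<delta> K\<close>
  (\<open>infinite_sprawling_tree_property_iff\<close>).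

  Such a \<open>K\<close> is contained in every iterate, so that \<open>ST(X, \<delta>) = \<infinity>\<close>.  Conversely, a countable set of
  countable ordinals is bounded, so if \<open>ST(X)\<close> is not countable, then there is one \<open>\<delta>\<close> for which no
  iterate is empty.  A decreasing \<open>\<omega>\<^sub>1\<close>-sequence of sets in a separable metric space has
  eventually constant closures (\<open>antimono_closures_stabilise\<close>), hence there is a countable \<open>c\<close> such
  that the nonempty set \<open>K = roots \<beta> \<delta> c\<close> is contained in the closure of \<open>sprawl \<delta> K\<close>.  Finally,
  the closure is removed at the price of a larger set: as \<open>sprawl \<delta>\<close> commutes with translations, the sum \<open>L\<close> of
  \<open>K\<close> and the open unit ball satisfies \<open>L \<subseteq> sprawl \<delta> L\<close> exactly (\<open>subset_sprawl_fattening\<close>).  Since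
  \<open>L\<close> lies in the ball of radius \<open>2\<close>, its half is the set that is needed, with \<open>\<delta>/2\<close> for \<open>\<delta>\<close>.
\<close>

section \<open>Countable ordinals\<close>

lemma countable_imp_bounded_omega1:
  fixes A :: "omega1 set"
  assumes "countable A"
  shows "\<exists>b. \<forall>a\<in>A. a \<le> b"
proof (rule ccontr)
  assume "\<not> ?thesis"
  then have "(UNIV :: omega1 set) = (\<Union>a\<in>A. {..<a})"
    by (auto simp: not_le)
  moreover have "countable (\<Union>a\<in>A. {..<a})"
    using assms countable_lessThan_omega1 by blast
  ultimately show False
    using uncountable_omega1 by metis
qed

lemma omega1_cases:
  obtains "a = ozero" | b where "a = osuc b" | "olimit a"
  by (auto simp: olimit_def)

text \<open>
  A ball of radius \<open>1/(n+1)\<close> about a point of a countable dense set either meets every \<open>R a\<close> or misses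
  all \<open>R a\<close> from some index on.  These are countably many balls, hence the indices have a common
  bound \<open>c\<close>; a ball that meets \<open>R c\<close> then meets every \<open>R a\<close>.
\<close>

lemma antimono_closures_stabilise:
  fixes R :: "omega1 \<Rightarrow> 'a::metric_space set"
  assumes "separable_space (euclidean :: 'a topology)" and "antimono R"
  shows "\<exists>c. \<forall>a. R c \<subseteq> closure (R a)"
proof -
  obtain C :: "'a set" where C: "countable C" "closure C = UNIV"
    using assms(1) by (auto simp: separable_space_def)
  define U where "U = (\<lambda>(d :: 'a, n). ball d (1 / real (Suc n)))"
  define g where "g q = (SOME a. U q \<inter> R a = {})" for q
  have "countable (g ` (C \<times> UNIV))"
    using C(1) by simp
  then obtain c where c: "\<And>q. q \<in> C \<times> UNIV \<Longrightarrow> g q \<le> c"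
    using countable_imp_bounded_omega1[of "g ` (C \<times> UNIV)"] by blast
  have "x \<in> closure (R a)" if "x \<in> R c" for x a
    unfolding closure_approachable
  proof (intro allI impI)
    fix \<epsilon> :: real assume "\<epsilon> > 0"
    then obtain n where n: "1 / real (Suc n) < \<epsilon> / 2"
      using nat_approx_posE[of "\<epsilon> / 2"] by auto
    have "x \<in> closure C"
      using C(2) by simp
    then obtain d where d: "d \<in> C" "dist d x < 1 / real (Suc n)"
      unfolding closure_approachable by (metis of_nat_0_less_iff zero_less_Suc zero_less_divide_1_iff)
    have "U (d, n) \<inter> R c \<noteq> {}"
      using that d by (auto simp: U_def)
    have "U (d, n) \<inter> R a \<noteq> {}"
    proof
      assume "U (d, n) \<inter> R a = {}"
      then have "U (d, n) \<inter> R (g (d, n)) = {}"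
        unfolding g_def by (rule someI)
      moreover have "R c \<subseteq> R (g (d, n))"
        using c[of "(d, n)"] d(1) assms(2) by (auto dest: antimonoD)
      ultimately show False
        using \<open>U (d, n) \<inter> R c \<noteq> {}\<close> by blast
    qed
    then obtain y where "y \<in> R a" "dist d y < 1 / real (Suc n)"
      by (auto simp: U_def)
    then show "\<exists>y\<in>R a. dist y x < \<epsilon>"
      using d(2) n dist_triangle[of y x d] by (intro bexI[of _ y]) (auto simp: dist_commute)
  qed
  then show ?thesis by blast
qed

section \<open>The sprawling operator\<close>

definition sprawl :: "real \<Rightarrow> 'a::real_normed_vector set \<Rightarrow> 'a set" where
  "sprawl \<delta> K = {x. \<exists>u :: bool \<times> nat \<Rightarrow> 'a. range u \<subseteq> K \<and>
     (\<forall>n. x = (1/2) *\<^sub>R (u (False, n) + u (True, n))) \<and>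
     (\<forall>n m. n \<noteq> m \<longrightarrow> norm (u (False, n) - u (False, m)) \<ge> \<delta>)}"

lemma sprawl_mono: "K \<subseteq> L \<Longrightarrow> sprawl \<delta> K \<subseteq> sprawl \<delta> L"
  unfolding sprawl_def by blast

lemma sprawl_cball: "sprawl \<delta> (cball 0 r) \<subseteq> cball 0 r"
proof
  fix x :: 'a assume "x \<in> sprawl \<delta> (cball 0 r)"
  then obtain u :: "bool \<times> nat \<Rightarrow> 'a"
    where u: "range u \<subseteq> cball 0 r" "x = (1/2) *\<^sub>R (u (False, 0) + u (True, 0))"
    unfolding sprawl_def by blast
  have "norm (u p) \<le> r" for p
    using u(1) by (cases p) (auto simp: image_subset_iff)
  then have "norm (u (False, 0) + u (True, 0)) \<le> r + r"
    by (meson add_mono norm_triangle_ineq order_trans)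
  then show "x \<in> cball 0 r"
    by (simp add: u(2))
qed

lemma sprawl_translation:
  assumes "x \<in> sprawl \<delta> K"
  shows "e + x \<in> sprawl \<delta> ((+) e ` K)"
proof -
  obtain u :: "bool \<times> nat \<Rightarrow> 'a" where u: "range u \<subseteq> K"
      "\<And>n. x = (1/2) *\<^sub>R (u (False, n) + u (True, n))"
      "\<And>n m. n \<noteq> m \<Longrightarrow> norm (u (False, n) - u (False, m)) \<ge> \<delta>"
    using assms unfolding sprawl_def by blast
  have "e + x = (1/2) *\<^sub>R ((e + u (False, n)) + (e + u (True, n)))" for n
  proof -
    have "e + x = (1/2) *\<^sub>R (e + e) + (1/2) *\<^sub>R (u (False, n) + u (True, n))"
      using u(2)[of n] by (simp add: scaleR_half_double)
    then show ?thesis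
      by (simp add: scaleR_add_right algebra_simps)
  qed
  with u(1,3) show ?thesis
    unfolding sprawl_def by (intro CollectI exI[of _ "\<lambda>p. e + u p"]) auto
qed

lemma sprawl_scaleR:
  assumes "x \<in> sprawl \<delta> K"
  shows "c *\<^sub>R x \<in> sprawl (\<bar>c\<bar> * \<delta>) ((*\<^sub>R) c ` K)"
proof -
  obtain u :: "bool \<times> nat \<Rightarrow> 'a" where u: "range u \<subseteq> K"
      "\<And>n. x = (1/2) *\<^sub>R (u (False, n) + u (True, n))"
      "\<And>n m. n \<noteq> m \<Longrightarrow> norm (u (False, n) - u (False, m)) \<ge> \<delta>"
    using assms unfolding sprawl_def by blast
  have "c *\<^sub>R x = (1/2) *\<^sub>R (c *\<^sub>R u (False, n) + c *\<^sub>R u (True, n))" for n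
    by (subst u(2)[of n]) (simp add: scaleR_add_right mult.commute)
  moreover have "norm (c *\<^sub>R u (False, n) - c *\<^sub>R u (False, m)) \<ge> \<bar>c\<bar> * \<delta>" if "n \<noteq> m" for n m
    using u(3)[OF that] by (simp add: scaleR_diff_right[symmetric] mult_left_mono)
  ultimately show ?thesis
    using u(1) unfolding sprawl_def by (intro CollectI exI[of _ "\<lambda>p. c *\<^sub>R u p"]) auto
qed

text \<open>
  Let \<open>x = e + y\<close> with \<open>y \<in> K\<close> and \<open>norm e < 1\<close>.  The slack \<open>1 - norm e\<close> is positive, so there is
  \<open>z \<in> sprawl \<delta> K\<close> within this distance of \<open>y\<close>, and \<open>x = e' + z\<close> where \<open>e' = e + (y - z)\<close> is again in
  the open unit ball.  Moving a pair representing \<open>z\<close> by \<open>e'\<close> represents \<open>x\<close> exactly and does not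
  change the distances.
\<close>

lemma subset_sprawl_fattening:
  assumes "K \<subseteq> closure (sprawl \<delta> K)"
  defines "L \<equiv> {e + y | e y. e \<in> ball 0 1 \<and> y \<in> K}"
  shows "L \<subseteq> sprawl \<delta> L"
proof
  fix x assume "x \<in> L"
  then obtain e y where x: "x = e + y" "norm e < 1" "y \<in> K"
    by (auto simp: L_def)
  from x(2,3) assms(1) obtain z where z: "z \<in> sprawl \<delta> K" "dist z y < 1 - norm e"
    by (metis closure_approachable diff_gt_0_iff_gt subsetD)
  define e' where "e' = e + (y - z)"
  have "norm e' < 1"
    using z(2) norm_triangle_ineq[of e "y - z"] by (simp add: e'_def dist_norm norm_minus_commute)
  then have "(+) e' ` K \<subseteq> L"
    by (auto simp: L_def)
  moreover have "x = e' + z"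
    by (simp add: x(1) e'_def)
  ultimately show "x \<in> sprawl \<delta> L"
    using sprawl_translation[OF z(1)] sprawl_mono by blast
qed

text \<open>
  An infinite tree is grown from any point of \<open>K\<close> by choosing, for every \<open>y \<in> K\<close> once and for all, a
  family \<open>u y\<close> that witnesses \<open>y \<in> sprawl \<delta> K\<close>.
\<close>

lemma infinite_sprawling_tree_property_iff:
  "infinite_sprawling_tree_property TYPE('a::real_normed_vector) \<longleftrightarrow>
    (\<exists>\<delta>>0. \<exists>K :: 'a set. K \<noteq> {} \<and> K \<subseteq> cball 0 1 \<and> K \<subseteq> sprawl \<delta> K)"
proof
  assume "infinite_sprawling_tree_property TYPE('a)"
  then obtain \<delta> and f :: "(bool \<times> nat) list \<Rightarrow> 'a" where f: "\<delta> > 0" "range f \<subseteq> cball 0 1"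
      "\<forall>s. (\<forall>n. f s = (1/2) *\<^sub>R (f (s @ [(False, n)]) + f (s @ [(True, n)]))) \<and>
        (\<forall>n m. n \<noteq> m \<longrightarrow> norm (f (s @ [(False, n)]) - f (s @ [(False, m)])) \<ge> \<delta>)"
    unfolding infinite_sprawling_tree_property_def by (elim exE conjE)
  have "f s \<in> sprawl \<delta> (range f)" for s
    unfolding sprawl_def using spec[OF f(3), of s]
    by (intro CollectI exI[of _ "\<lambda>p. f (s @ [p])"] conjI image_subsetI rangeI) (erule conjunct1 conjunct2)+
  with f(1,2) show "\<exists>\<delta>>0. \<exists>K :: 'a set. K \<noteq> {} \<and> K \<subseteq> cball 0 1 \<and> K \<subseteq> sprawl \<delta> K"
    by (intro exI[of _ \<delta>] conjI exI[of _ "range f"]) auto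
next
  assume "\<exists>\<delta>>0. \<exists>K :: 'a set. K \<noteq> {} \<and> K \<subseteq> cball 0 1 \<and> K \<subseteq> sprawl \<delta> K"
  then obtain \<delta> x and K :: "'a set"
    where K: "\<delta> > 0" "x \<in> K" "K \<subseteq> cball 0 1" "K \<subseteq> sprawl \<delta> K"
    by blast
  have "\<forall>y\<in>K. \<exists>u :: bool \<times> nat \<Rightarrow> 'a. range u \<subseteq> K \<and>
     (\<forall>n. y = (1/2) *\<^sub>R (u (False, n) + u (True, n))) \<and>
     (\<forall>n m. n \<noteq> m \<longrightarrow> norm (u (False, n) - u (False, m)) \<ge> \<delta>)"
    using K(4) unfolding sprawl_def by blast
  then obtain u :: "'a \<Rightarrow> bool \<times> nat \<Rightarrow> 'a" where u:
      "\<And>y. y \<in> K \<Longrightarrow> range (u y) \<subseteq> K"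
      "\<And>y n. y \<in> K \<Longrightarrow> y = (1/2) *\<^sub>R (u y (False, n) + u y (True, n))"
      "\<And>y n m. y \<in> K \<Longrightarrow> n \<noteq> m \<Longrightarrow> norm (u y (False, n) - u y (False, m)) \<ge> \<delta>"
    by metis
  define f where "f = foldl u x"
  have step: "f (s @ [p]) = u (f s) p" for s p
    by (simp add: f_def)
  have f: "f s \<in> K" for s
  proof (induction s rule: rev_induct)
    case Nil
    then show ?case by (simp add: f_def K(2))
  next
    case (snoc p s)
    then show ?case using u(1) by (auto simp: step)
  qed
  have "range f \<subseteq> cball 0 1"
    using f K(3) by blast
  moreover have "f s = (1/2) *\<^sub>R (f (s @ [(False, n)]) + f (s @ [(True, n)]))" for s n
    unfolding step using u(2)[OF f] .
  moreover have "norm (f (s @ [(False, n)]) - f (s @ [(False, m)])) \<ge> \<delta>" if "n \<noteq> m" for s n m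
    unfolding step using u(3)[OF f that] .
  ultimately show "infinite_sprawling_tree_property TYPE('a)"
    unfolding infinite_sprawling_tree_property_def using K(1) by blast
qed

section \<open>Subtrees of sprawling trees\<close>

text \<open>
  The type of a node can be read off in the tree that hangs above the first entry.
\<close>

lemma successors_Cons: "successors S (p # t) = (#) p ` successors {t. p # t \<in> S} t"
  by (auto simp: successors_def)

lemma type_B_Cons: "type_B S (p # t) \<longleftrightarrow> type_B {t. p # t \<in> S} t"
proof -
  have "(\<Union>n. {(p # t) @ [(False, n)], (p # t) @ [(True, n)]}) =
      (#) p ` (\<Union>n. {t @ [(False, n)], t @ [(True, n)]})"
    by auto
  then show ?thesis
    unfolding type_B_def successors_Cons by (simp add: inj_image_eq_iff inj_on_def)
qed

lemma type_C_Cons: "type_C S (p # t) \<longleftrightarrow> type_C {t. p # t \<in> S} t"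
proof -
  have "(\<Union>n. {(p # t) @ [(False, n)]}) = (#) p ` (\<Union>n. {t @ [(False, n)]})"
    by auto
  then show ?thesis
    unfolding type_C_def successors_Cons by (simp add: inj_image_eq_iff inj_on_def)
qed

definition sprawls_at ::
  "real \<Rightarrow> (bool \<times> nat) list set \<Rightarrow> ((bool \<times> nat) list \<Rightarrow> 'a::real_normed_vector) \<Rightarrow>
    (bool \<times> nat) list \<Rightarrow> bool" where
  "sprawls_at \<delta> S x s \<longleftrightarrow>
    (type_B S s \<longrightarrow>
      (\<forall>n. x s = (1/2) *\<^sub>R (x (s @ [(False, n)]) + x (s @ [(True, n)]))) \<and>
      (\<forall>n m. n \<noteq> m \<longrightarrow> norm (x (s @ [(False, n)]) - x (s @ [(False, m)])) \<ge> \<delta>)) \<and>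
    (type_C S s \<longrightarrow> (\<forall>n. x s = x (s @ [(False, n)])))"

lemma sprawling_tree_iff: "sprawling_tree \<beta> \<delta> a x \<longleftrightarrow> (\<forall>s\<in>seq_tree \<beta> a. sprawls_at \<delta> (seq_tree \<beta> a) x s)"
  by (simp add: sprawling_tree_def sprawls_at_def)

lemma sprawls_at_Cons:
  "sprawls_at \<delta> S x (p # t) \<longleftrightarrow> sprawls_at \<delta> {t. p # t \<in> S} (\<lambda>t. x (p # t)) t"
  by (simp add: sprawls_at_def type_B_Cons type_C_Cons)

lemma Nil_in_seq_tree: "[] \<in> seq_tree \<beta> a"
  by (simp add: seq_tree_def seq_tree_mem.empty)

lemma Cons_in_seq_tree_osuc: "p # t \<in> seq_tree \<beta> (osuc a) \<longleftrightarrow> t \<in> seq_tree \<beta> a"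
  by (cases p; cases "fst p") (auto simp: seq_tree_osuc)

lemma Cons_in_seq_tree_limit:
  "olimit a \<Longrightarrow> (i, n) # t \<in> seq_tree \<beta> a \<longleftrightarrow> \<not> i \<and> t \<in> seq_tree \<beta> (\<beta> a n)"
  by (auto simp: seq_tree_limit)

lemma ball_seq_tree_osuc:
  "(\<forall>s\<in>seq_tree \<beta> (osuc a). P s) \<longleftrightarrow> P [] \<and> (\<forall>p. \<forall>t\<in>seq_tree \<beta> a. P (p # t))"
proof -
  have "seq_tree \<beta> (osuc a) = insert [] (\<Union>p. (#) p ` seq_tree \<beta> a)"
    by (auto simp: seq_tree_osuc image_iff)
  then show ?thesis
    by auto
qed

lemma ball_seq_tree_limit:
  assumes "olimit a"
  shows "(\<forall>s\<in>seq_tree \<beta> a. P s) \<longleftrightarrow> P [] \<and> (\<forall>n. \<forall>t\<in>seq_tree \<beta> (\<beta> a n). P ((False, n) # t))"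
  by (auto simp: seq_tree_limit[OF assms])

lemma sprawls_at_root_osuc:
  "sprawls_at \<delta> (seq_tree \<beta> (osuc a)) x [] \<longleftrightarrow>
    (\<forall>n. x [] = (1/2) *\<^sub>R (x [(False, n)] + x [(True, n)])) \<and>
    (\<forall>n m. n \<noteq> m \<longrightarrow> norm (x [(False, n)] - x [(False, m)]) \<ge> \<delta>)"
proof -
  have succ: "successors (seq_tree \<beta> (osuc a)) [] = {[p] | p. True}"
    by (simp add: successors_def Cons_in_seq_tree_osuc Nil_in_seq_tree)
  have B: "type_B (seq_tree \<beta> (osuc a)) []"
    unfolding type_B_def succ by auto
  have "[(True, 0)] \<in> successors (seq_tree \<beta> (osuc a)) []"
    unfolding succ by blast
  then have "\<not> type_C (seq_tree \<beta> (osuc a)) []"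
    unfolding type_C_def by auto
  with B show ?thesis
    by (simp add: sprawls_at_def)
qed

lemma sprawls_at_root_limit:
  assumes "olimit a"
  shows "sprawls_at \<delta> (seq_tree \<beta> a) x [] \<longleftrightarrow> (\<forall>n. x [] = x [(False, n)])"
proof -
  have succ: "successors (seq_tree \<beta> a) [] = {[(False, n)] | n. True}"
    using assms by (auto simp: successors_def Cons_in_seq_tree_limit Nil_in_seq_tree)
  have "[(True, 0)] \<notin> successors (seq_tree \<beta> a) []"
    unfolding succ by simp
  then have "\<not> type_B (seq_tree \<beta> a) []"
    unfolding type_B_def by force
  moreover have "type_C (seq_tree \<beta> a) []"
    unfolding type_C_def succ by auto
  ultimately show ?thesis
    by (simp add: sprawls_at_def)
qed

lemma sprawling_tree_osuc:
  "sprawling_tree \<beta> \<delta> (osuc a) x \<longleftrightarrow>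
    (\<forall>n. x [] = (1/2) *\<^sub>R (x [(False, n)] + x [(True, n)])) \<and>
    (\<forall>n m. n \<noteq> m \<longrightarrow> norm (x [(False, n)] - x [(False, m)]) \<ge> \<delta>) \<and>
    (\<forall>p. sprawling_tree \<beta> \<delta> a (\<lambda>t. x (p # t)))"
  unfolding sprawling_tree_iff ball_seq_tree_osuc sprawls_at_root_osuc
  by (simp add: sprawls_at_Cons Cons_in_seq_tree_osuc)

lemma sprawling_tree_limit:
  assumes "olimit a"
  shows "sprawling_tree \<beta> \<delta> a x \<longleftrightarrow>
    (\<forall>n. x [] = x [(False, n)]) \<and> (\<forall>n. sprawling_tree \<beta> \<delta> (\<beta> a n) (\<lambda>t. x ((False, n) # t)))"
  unfolding sprawling_tree_iff ball_seq_tree_limit[OF assms] sprawls_at_root_limit[OF assms]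
  by (simp add: sprawls_at_Cons Cons_in_seq_tree_limit[OF assms])

section \<open>The roots of the sprawling trees in the ball\<close>

definition sprawls_in_ball ::
  "(omega1 \<Rightarrow> nat \<Rightarrow> omega1) \<Rightarrow> real \<Rightarrow> omega1 \<Rightarrow> ((bool \<times> nat) list \<Rightarrow> 'a::real_normed_vector) \<Rightarrow> bool"
  where "sprawls_in_ball \<beta> \<delta> a x \<longleftrightarrow>
    sprawling_tree \<beta> \<delta> a x \<and> (\<forall>s\<in>seq_tree \<beta> a. x s \<in> cball 0 1)"

definition roots :: "(omega1 \<Rightarrow> nat \<Rightarrow> omega1) \<Rightarrow> real \<Rightarrow> omega1 \<Rightarrow> 'a::real_normed_vector set" where
  "roots \<beta> \<delta> a = {x [] | x. sprawls_in_ball \<beta> \<delta> a x}"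

lemma ball_contains_sprawling_tree_iff:
  "ball_contains_sprawling_tree TYPE('a::real_normed_vector) \<beta> \<delta> a \<longleftrightarrow> (roots \<beta> \<delta> a :: 'a set) \<noteq> {}"
  by (auto simp: ball_contains_sprawling_tree_def roots_def sprawls_in_ball_def image_subset_iff)

lemma roots_subset_cball: "roots \<beta> \<delta> a \<subseteq> cball 0 1"
  using Nil_in_seq_tree by (auto simp: roots_def sprawls_in_ball_def simp del: mem_cball)

lemma roots_ozero: "roots \<beta> \<delta> ozero = cball 0 1"
proof
  have "sprawls_in_ball \<beta> \<delta> ozero (\<lambda>_. x)" if "x \<in> cball 0 1" for x :: 'a
    using that by (auto simp: sprawls_in_ball_def sprawling_tree_def seq_tree_ozero
        type_B_def type_C_def successors_def)
  then show "cball 0 1 \<subseteq> (roots \<beta> \<delta> ozero :: 'a set)"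
    by (force simp: roots_def simp del: mem_cball)
qed (rule roots_subset_cball)

lemma roots_osuc: "roots \<beta> \<delta> (osuc a) = sprawl \<delta> (roots \<beta> \<delta> a)"
proof
  show "roots \<beta> \<delta> (osuc a) \<subseteq> (sprawl \<delta> (roots \<beta> \<delta> a) :: 'a set)"
  proof
    fix y :: 'a assume "y \<in> roots \<beta> \<delta> (osuc a)"
    then obtain x where x: "y = x []" "sprawls_in_ball \<beta> \<delta> (osuc a) x"
      by (auto simp: roots_def)
    then have "sprawls_in_ball \<beta> \<delta> a (\<lambda>t. x (p # t))" for p
      by (cases p) (simp add: sprawls_in_ball_def sprawling_tree_osuc ball_seq_tree_osuc)
    then have "x [p] \<in> roots \<beta> \<delta> a" for p
      unfolding roots_def by (intro CollectI exI[of _ "\<lambda>t. x (p # t)"]) simp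
    then show "y \<in> sprawl \<delta> (roots \<beta> \<delta> a)"
      using x unfolding sprawl_def
      by (intro CollectI exI[of _ "\<lambda>p. x [p]"]) (auto simp: sprawls_in_ball_def sprawling_tree_osuc)
  qed
next
  show "(sprawl \<delta> (roots \<beta> \<delta> a) :: 'a set) \<subseteq> roots \<beta> \<delta> (osuc a)"
  proof
    fix y :: 'a assume y: "y \<in> sprawl \<delta> (roots \<beta> \<delta> a)"
    then obtain u :: "bool \<times> nat \<Rightarrow> 'a" where u: "range u \<subseteq> roots \<beta> \<delta> a"
        "\<And>n. y = (1/2) *\<^sub>R (u (False, n) + u (True, n))"
        "\<And>n m. n \<noteq> m \<Longrightarrow> norm (u (False, n) - u (False, m)) \<ge> \<delta>"
      unfolding sprawl_def by blast
    have "\<forall>p. \<exists>x. u p = x [] \<and> sprawls_in_ball \<beta> \<delta> a x"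
      using u(1) by (auto simp: roots_def image_subset_iff)
    then obtain X where X: "\<And>p. u p = X p []" "\<And>p. sprawls_in_ball \<beta> \<delta> a (X p)"
      by metis
    define x where "x s = (case s of [] \<Rightarrow> y | p # t \<Rightarrow> X p t)" for s
    have "y \<in> cball 0 1"
      using y sprawl_mono[OF roots_subset_cball] sprawl_cball by blast
    then have "sprawls_in_ball \<beta> \<delta> (osuc a) x"
      using X(2) u(2,3)
      by (simp add: sprawls_in_ball_def sprawling_tree_osuc ball_seq_tree_osuc x_def X(1)[symmetric])
    moreover have "x [] = y"
      by (simp add: x_def)
    ultimately show "y \<in> roots \<beta> \<delta> (osuc a)"
      unfolding roots_def by blast
  qed
qed

lemma roots_limit:
  assumes "limit_enumeration \<beta>" and a: "olimit a"
  shows "roots \<beta> \<delta> a = (\<Inter>b\<in>{..<a}. roots \<beta> \<delta> b)"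
proof -
  have "roots \<beta> \<delta> a = (\<Inter>n. roots \<beta> \<delta> (\<beta> a n) :: 'a set)"
  proof
    show "roots \<beta> \<delta> a \<subseteq> (\<Inter>n. roots \<beta> \<delta> (\<beta> a n) :: 'a set)"
    proof
      fix y :: 'a assume "y \<in> roots \<beta> \<delta> a"
      then obtain x where x: "y = x []" "sprawls_in_ball \<beta> \<delta> a x"
        by (auto simp: roots_def)
      then have "sprawls_in_ball \<beta> \<delta> (\<beta> a n) (\<lambda>t. x ((False, n) # t))" "y = x [(False, n)]" for n
        by (simp_all add: sprawls_in_ball_def sprawling_tree_limit[OF a] ball_seq_tree_limit[OF a])
      then show "y \<in> (\<Inter>n. roots \<beta> \<delta> (\<beta> a n))"
        unfolding roots_def by force
    qed
  next
    show "(\<Inter>n. roots \<beta> \<delta> (\<beta> a n) :: 'a set) \<subseteq> roots \<beta> \<delta> a"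
    proof
      fix y :: 'a assume y: "y \<in> (\<Inter>n. roots \<beta> \<delta> (\<beta> a n))"
      then have "\<forall>n. \<exists>x. y = x [] \<and> sprawls_in_ball \<beta> \<delta> (\<beta> a n) x"
        by (auto simp: roots_def)
      then obtain X where X: "\<And>n. X n [] = y" "\<And>n. sprawls_in_ball \<beta> \<delta> (\<beta> a n) (X n)"
        by metis
      define x where "x s = (case s of [] \<Rightarrow> y | p # t \<Rightarrow> X (snd p) t)" for s
      have "y \<in> cball 0 1"
        using y roots_subset_cball by blast
      then have "sprawls_in_ball \<beta> \<delta> a x"
        using X
        by (simp add: sprawls_in_ball_def sprawling_tree_limit[OF a] ball_seq_tree_limit[OF a] x_def)
      moreover have "x [] = y"
        by (simp add: x_def)
      ultimately show "y \<in> roots \<beta> \<delta> a"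
        unfolding roots_def by blast
    qed
  qed
  moreover have "range (\<beta> a) = {..<a}"
    using assms by (simp add: limit_enumeration_def)
  moreover have "(\<Inter>n. roots \<beta> \<delta> (\<beta> a n) :: 'a set) = (\<Inter>b\<in>range (\<beta> a). roots \<beta> \<delta> b)"
    by simp
  ultimately show ?thesis
    by (simp only:)
qed

text \<open>
  The iterates of a monotone operator decrease as soon as the first step does not leave the initial
  set, here the ball, which is convex.
\<close>

lemma sprawl_roots_subset:
  assumes "limit_enumeration \<beta>"
  shows "sprawl \<delta> (roots \<beta> \<delta> a) \<subseteq> (roots \<beta> \<delta> a :: 'a::real_normed_vector set)"
proof (induction a rule: less_induct)
  case (less a)
  show ?case
  proof (cases a rule: omega1_cases)
    case 1
    then show ?thesis by (simp add: roots_ozero sprawl_cball)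
  next
    case (2 b)
    then show ?thesis using less[of b] less_osuc[of b] by (simp add: roots_osuc sprawl_mono)
  next
    case 3
    have "sprawl \<delta> (roots \<beta> \<delta> a) \<subseteq> (roots \<beta> \<delta> b :: 'a set)" if "b < a" for b
    proof -
      have "roots \<beta> \<delta> a \<subseteq> (roots \<beta> \<delta> b :: 'a set)"
        using that by (auto simp: roots_limit[OF assms 3])
      then show ?thesis
        using less[OF that] sprawl_mono subset_trans by metis
    qed
    then show ?thesis
      using roots_limit[OF assms 3] by blast
  qed
qed

lemma antimono_roots:
  assumes "limit_enumeration \<beta>"
  shows "antimono (roots \<beta> \<delta> :: omega1 \<Rightarrow> 'a::real_normed_vector set)"
proof
  fix a b :: omega1
  assume "a \<le> b"
  then show "roots \<beta> \<delta> b \<subseteq> (roots \<beta> \<delta> a :: 'a set)"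
  proof (induction b rule: less_induct)
    case (less b)
    show ?case
    proof (cases "a = b")
      case False
      with less.prems have "a < b" by simp
      show ?thesis
      proof (cases b rule: omega1_cases)
        case 1
        then show ?thesis using \<open>a < b\<close> ozero_le[of a] by simp
      next
        case (2 c)
        then have "roots \<beta> \<delta> c \<subseteq> (roots \<beta> \<delta> a :: 'a set)"
          using less.IH[of c] \<open>a < b\<close> less_osuc[of c] by (simp add: less_osuc_iff)
        then show ?thesis
          using sprawl_roots_subset[OF assms, of \<delta> c] unfolding 2 roots_osuc by (rule subset_trans[rotated])
      next
        case 3
        then show ?thesis using \<open>a < b\<close> by (auto simp: roots_limit[OF assms 3])
      qed
    qed simp
  qed
qed

lemma subset_roots:
  assumes "limit_enumeration \<beta>" and "K \<subseteq> cball 0 1" and "K \<subseteq> sprawl \<delta> K"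
  shows "K \<subseteq> roots \<beta> \<delta> a"
proof (induction a rule: less_induct)
  case (less a)
  show ?case
  proof (cases a rule: omega1_cases)
    case 1
    then show ?thesis by (simp add: roots_ozero assms(2))
  next
    case (2 b)
    then show ?thesis
      using subset_trans[OF assms(3) sprawl_mono[OF less[of b]]] less_osuc[of b]
      by (simp add: roots_osuc)
  next
    case 3
    then show ?thesis using less by (auto simp: roots_limit[OF assms(1) 3])
  qed
qed

section \<open>The index and the infinite tree\<close>

lemma roots_antimono_delta:
  assumes "\<delta> \<le> \<delta>'"
  shows "roots \<beta> \<delta>' a \<subseteq> roots \<beta> \<delta> a"
proof -
  have "sprawling_tree \<beta> \<delta> a x" if "sprawling_tree \<beta> \<delta>' a x" for x :: "_ \<Rightarrow> 'a"
    using that assms unfolding sprawling_tree_def by (meson order_trans)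
  then show ?thesis
    by (auto simp: roots_def sprawls_in_ball_def)
qed

lemma ST_delta_eq_Infty:
  assumes "\<And>a. ball_contains_sprawling_tree TYPE('a::real_normed_vector) \<beta> \<delta> a"
  shows "ST_delta TYPE('a) \<beta> \<delta> = Infty"
  using assms by (simp add: ST_delta_def Inf_ord_inf_def)

lemma ST_delta_le:
  assumes "\<not> ball_contains_sprawling_tree TYPE('a::real_normed_vector) \<beta> \<delta> a"
  shows "ST_delta TYPE('a) \<beta> \<delta> \<le> Ctbl a"
  unfolding ST_delta_def using assms by (intro Inf_lower) auto

text \<open>
  The index \<open>ST(X, \<delta>)\<close> is never \<open>\<omega>\<^sub>1\<close>, and the supremum over \<open>\<delta>\<close> is a supremum over the countably
  many \<open>\<delta> = 1/(n+1)\<close>, so it can be uncountable only because some \<open>ST(X, \<delta>)\<close> is \<open>\<infinity>\<close>.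
\<close>

lemma ST_less_Omega1_iff:
  "ST TYPE('a::real_normed_vector) \<beta> < Omega1 \<longleftrightarrow>
    (\<forall>\<delta>>0. \<exists>a. (roots \<beta> \<delta> a :: 'a set) = {})"
proof
  assume less: "ST TYPE('a) \<beta> < Omega1"
  show "\<forall>\<delta>>0. \<exists>a. (roots \<beta> \<delta> a :: 'a set) = {}"
  proof (intro allI impI, rule ccontr)
    fix \<delta> :: real assume "\<delta> > 0" and "\<nexists>a. (roots \<beta> \<delta> a :: 'a set) = {}"
    then have "ST_delta TYPE('a) \<beta> \<delta> = Infty"
      by (intro ST_delta_eq_Infty) (simp add: ball_contains_sprawling_tree_iff)
    then have "Infty \<le> ST TYPE('a) \<beta>"
      unfolding ST_def using \<open>\<delta> > 0\<close> by (metis SUP_upper greaterThan_iff)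
    then show False
      using less by (cases "ST TYPE('a) \<beta>") (auto simp: less_ord_inf_def)
  qed
next
  assume *: "\<forall>\<delta>>0. \<exists>a. (roots \<beta> \<delta> a :: 'a set) = {}"
  have "\<forall>n. \<exists>a. (roots \<beta> (1 / real (Suc n)) a :: 'a set) = {}"
    using * by simp
  then obtain g where g: "\<And>n. (roots \<beta> (1 / real (Suc n)) (g n) :: 'a set) = {}"
    by metis
  obtain b where b: "\<And>n. g n \<le> b"
    using countable_imp_bounded_omega1[of "range g"] by auto
  have "ST_delta TYPE('a) \<beta> \<delta> \<le> Ctbl b" if pos: "\<delta> > 0" for \<delta>
  proof -
    obtain n where "1 / real (Suc n) < \<delta>"
      using nat_approx_posE[OF pos] by blast
    then have "(roots \<beta> \<delta> (g n) :: 'a set) = {}"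
      using g[of n] roots_antimono_delta[of "1 / real (Suc n)" \<delta>] by force
    then have "ST_delta TYPE('a) \<beta> \<delta> \<le> Ctbl (g n)"
      by (intro ST_delta_le) (simp add: ball_contains_sprawling_tree_iff)
    also have "\<dots> \<le> Ctbl b"
      using b by simp
    finally show ?thesis .
  qed
  then have "ST TYPE('a) \<beta> \<le> Ctbl b"
    unfolding ST_def by (intro SUP_least) simp
  also have "\<dots> < Omega1"
    by (simp add: less_ord_inf_def)
  finally show "ST TYPE('a) \<beta> < Omega1" .
qed

theorem theorem3p23:
  fixes \<beta> :: "omega1 \<Rightarrow> nat \<Rightarrow> omega1"
  assumes "limit_enumeration \<beta>"
    and "separable_space (euclidean :: 'a::banach topology)"
  shows "\<not> infinite_sprawling_tree_property TYPE('a) \<longleftrightarrow> ST TYPE('a) \<beta> < Omega1"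
proof -
  have "infinite_sprawling_tree_property TYPE('a) \<longleftrightarrow>
      (\<exists>\<delta>>0. \<forall>a. (roots \<beta> \<delta> a :: 'a set) \<noteq> {})"
  proof
    assume "infinite_sprawling_tree_property TYPE('a)"
    then obtain \<delta> and K :: "'a set"
      where "\<delta> > 0" "K \<noteq> {}" "K \<subseteq> cball 0 1" "K \<subseteq> sprawl \<delta> K"
      unfolding infinite_sprawling_tree_property_iff by blast
    then show "\<exists>\<delta>>0. \<forall>a. (roots \<beta> \<delta> a :: 'a set) \<noteq> {}"
      using subset_roots[OF assms(1)] by (metis subset_empty)
  next
    assume "\<exists>\<delta>>0. \<forall>a. (roots \<beta> \<delta> a :: 'a set) \<noteq> {}"
    then obtain \<delta> where "\<delta> > 0" and nonempty: "\<And>a. (roots \<beta> \<delta> a :: 'a set) \<noteq> {}"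
      by blast
    obtain c where c: "\<And>a. (roots \<beta> \<delta> c :: 'a set) \<subseteq> closure (roots \<beta> \<delta> a)"
      using antimono_closures_stabilise[OF assms(2) antimono_roots[OF assms(1)]] by blast
    define K where "K = (roots \<beta> \<delta> c :: 'a set)"
    define L where "L = {e + y | e y. e \<in> ball 0 1 \<and> y \<in> K}"
    have "K \<subseteq> closure (sprawl \<delta> K)"
      using c[of "osuc c"] by (simp add: K_def roots_osuc)
    then have "L \<subseteq> sprawl \<delta> L"
      unfolding L_def by (rule subset_sprawl_fattening)
    then have "(*\<^sub>R) (1/2) ` L \<subseteq> sprawl (\<delta> / 2) ((*\<^sub>R) (1/2) ` L)"
      using sprawl_scaleR[of _ \<delta> L "1/2"] by auto
    moreover have "K \<subseteq> L"
      unfolding L_def by force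
    then have "(*\<^sub>R) (1/2) ` L \<noteq> {}"
      using nonempty[of c] by (auto simp: K_def)
    moreover have "norm (e + y) \<le> 2" if "norm e < 1" "y \<in> K" for e y
      using that norm_triangle_ineq[of e y] roots_subset_cball[of \<beta> \<delta> c] by (force simp: K_def)
    then have "(*\<^sub>R) (1/2) ` L \<subseteq> cball 0 1"
      by (auto simp: L_def)
    ultimately show "infinite_sprawling_tree_property TYPE('a)"
      unfolding infinite_sprawling_tree_property_iff using \<open>\<delta> > 0\<close>
      by (intro exI[of _ "\<delta> / 2"] exI[of _ "(*\<^sub>R) (1/2) ` L"] conjI) simp_all
  qed
  then show ?thesis
    by (auto simp: ST_less_Omega1_iff)
qed

end
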